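(* Let $K=\mathbb{R}$ or $K=\mathbb{C}$, $n\in\mathbb{Z}_{>0}$, and let $E=C_u(\mathbb{R}^n,K)$ or $E=C_0(\mathbb{R}^n,K)$. Let $V_j,W_j,W_{s,j}\subset E$ and $\tilde V_j,\tilde W_j,\tilde W_{s,j}\subset E^*$ be the spaces associated with an $n$-dimensional tensor product mother scaling function $\varphi^{[n]}$. Then: (i) for all $j\in\mathbb{Z}$ and $s,t\in\{0,1\}^n$: $s\ne t\iff\tilde W_{s,j}\perp W_{t,j}$; (ii) for all $j_1,j_2\in\mathbb{Z}$: $j_1\le j_2\iff\tilde V_{j_1}\perp W_{j_2}$; (iii) for all $j_1,j_2\in\mathbb{Z}$: $j_1\ge j_2\iff\tilde W_{j_1}\perp V_{j_2}$; (iv) for all $j_1,j_2\in\mathbb{Z}$: $j_1\ne j_2\iff\tilde W_{j_1}\perp W_{j_2}$.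
   Context: $C_u(\mathbb{R}^n,K)$ (resp. $C_0(\mathbb{R}^n,K)$) is the Banach space of bounded uniformly continuous functions (resp. continuous functions vanishing at infinity) $\mathbb{R}^n\to K$, with the supremum norm; $E^*$ is the topological dual. For $A\subset E$ and $B\subset E^*$, $B\perp A$ means $\langle\tilde b,a\rangle=0$ for all $a\in A$, $\tilde b\in B$. $\varphi:\mathbb{R}\to K$ is continuous and compactly supported with $\varphi(k)=\delta_{k,0}$ for all $k\in\mathbb{Z}$ and $\varphi(x)=\sum_{k\in\mathbb{Z}}\varphi(k/2)\varphi(2x-k)$ for all $x\in\mathbb{R}$; $\varphi^{[n]}(x)=\prod_{i=1}^n\varphi(x_i)$. Put $\zeta_0=\varphi$, $\zeta_1=\varphi(2\cdot-1)$, $\psi^{[n]}_s(x)=\prod_{i=1}^n\zeta_{s_i}(x_i)$ for $s\in\{0,1\}^n$, and $\psi^{[n]}_{s,j,k}(x)=\psi^{[n]}_s(2^jx-k)$ for $j\in\mathbb{Z}$, $k\in\mathbb{Z}^n$. Let $\ell=\ell^\infty(\mathbb{Z}^n,K)$ if $E=C_u(\mathbb{R}^n,K)$ and $\ell=c_0(\mathbb{Z}^n,K)$ (families tending to $0$ at infinity) if $E=C_0(\mathbb{R}^n,K)$. Define $$W_{s,j}=\Bigl\{x\mapsto\sum_{k\in\mathbb{Z}^n}a_k\psi^{[n]}_{s,j,k}(x): a\in\ell\Bigr\},\qquad V_j=W_{(0,\dots,0),j},$$ and let $W_j$ be the direct sum of the $W_{s,j}$ over $s\in\{0,1\}^n\setminus\{(0,\dots,0)\}$.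 Put $\tilde g_{0,l}=\delta_{l,0}$ and $\tilde g_{1,l}=(-1)^{l-1}\varphi\bigl(\tfrac{1-l}{2}\bigr)$ for $l\in\mathbb{Z}$, and $\tilde g^{[n]}_{s,l}=\prod_{i=1}^n\tilde g_{s_i,l_i}$ for $s\in\{0,1\}^n$, $l\in\mathbb{Z}^n$. Define $\tilde\psi^{[n]}_{s,j,k}\in E^*$ by $\langle\tilde\psi^{[n]}_{s,j,k},f\rangle=\sum_{l\in\mathbb{Z}^n}\tilde g^{[n]}_{s,l}\,f\bigl(\tfrac{2k+l}{2^{j+1}}\bigr)$ (a finite sum; for $s=(0,\dots,0)$ it is $f\mapsto f(k/2^j)$). Define $$\tilde W_{s,j}=\Bigl\{\sum_{k\in\mathbb{Z}^n}d_k\tilde\psi^{[n]}_{s,j,k}: d\in\ell^1(\mathbb{Z}^n,K)\Bigr\},\qquad\tilde V_j=\tilde W_{(0,\dots,0),j},$$ and let $\tilde W_j$ be the direct sum of the $\tilde W_{s,j}$ over $s\in\{0,1\}^n\setminus\{(0,\dots,0)\}$. *)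

theory Defs
  imports "HOL-Analysis.Analysis"
begin

text \<open>
  The scalar field is a type \<open>'k :: {real_normed_field, banach}\<close>: by the Gelfand--Mazur theorem such
  a field is \<open>\<real>\<close> or \<open>\<complex>\<close>, and both \<^typ>\<open>real\<close> and \<^typ>\<open>complex\<close> are instances. The space
  \<open>\<real>\<^sup>n\<close> is \<open>real ^ 'n\<close>, and multi-indices \<open>k \<in> \<int>\<^sup>n\<close> are of type \<open>int ^ 'n\<close>.
\<close>

definition C_u :: "(real ^ 'n \<Rightarrow> 'k :: {real_normed_field, banach}) set" where
  "C_u = {f. bounded (range f) \<and> uniformly_continuous_on UNIV f}"

definition C_0 :: "(real ^ 'n \<Rightarrow> 'k :: {real_normed_field, banach}) set" where
  "C_0 = {f. continuous_on UNIV f \<and> (f \<longlongrightarrow> 0) at_infinity}"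

definition sup_norm :: "('a \<Rightarrow> 'k :: real_normed_vector) \<Rightarrow> real" where
  "sup_norm f = (SUP x. norm (f x))"

text \<open>
  \<^const>\<open>C_u\<close> and \<^const>\<open>C_0\<close> are sets of functions, so a functional on such a space \<open>E\<close> is represented
  by a function that is \<^const>\<open>undefined\<close> outside \<open>E\<close>; in particular,
  \<open>b f = 0\<close> is only provable for \<open>f \<in> E\<close>. Linearity is over \<open>'k\<close>.
\<close>

definition dual :: "('a \<Rightarrow> 'k) set \<Rightarrow> (('a \<Rightarrow> 'k :: {real_normed_field, banach}) \<Rightarrow> 'k) set" where
  "dual E = {b \<in> extensional E.
     (\<forall>f\<in>E. \<forall>g\<in>E. b (\<lambda>x. f x + g x) = b f + b g) \<and>
     (\<forall>c. \<forall>f\<in>E. b (\<lambda>x. c * f x) = c * b f) \<and>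
     (\<exists>C. \<forall>f\<in>E. norm (b f) \<le> C * sup_norm f)}"

definition dual_norm ::
    "('a \<Rightarrow> 'k) set \<Rightarrow> (('a \<Rightarrow> 'k :: {real_normed_field, banach}) \<Rightarrow> 'k) \<Rightarrow> real" where
  "dual_norm E b = (SUP f\<in>{f \<in> E. sup_norm f \<le> 1}. norm (b f))"

text \<open>
  \<open>b = \<Sum>\<^sub>k u\<^sub>k\<close>, with unordered convergence (as for \<^const>\<open>has_sum\<close>) in the norm of the dual space.
\<close>

definition dual_has_sum :: "('a \<Rightarrow> 'k) set \<Rightarrow> ('i \<Rightarrow> ('a \<Rightarrow> 'k) \<Rightarrow> 'k)
    \<Rightarrow> (('a \<Rightarrow> 'k :: {real_normed_field, banach}) \<Rightarrow> 'k) \<Rightarrow> bool" where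
  "dual_has_sum E u b \<longleftrightarrow> b \<in> dual E \<and>
     ((\<lambda>F. dual_norm E (\<lambda>f. b f - (\<Sum>k\<in>F. u k f))) \<longlongrightarrow> 0) (finite_subsets_at_top UNIV)"

definition perp :: "('e \<Rightarrow> 'k :: zero) set \<Rightarrow> 'e set \<Rightarrow> bool" (infix "\<perp>" 50) where
  "B \<perp> A \<longleftrightarrow> (\<forall>b\<in>B. \<forall>a\<in>A. b a = 0)"

definition mother_scaling_function :: "(real \<Rightarrow> 'k :: {real_normed_field, banach}) \<Rightarrow> bool" where
  "mother_scaling_function \<phi> \<longleftrightarrow>
     continuous_on UNIV \<phi> \<and> compact (closure {x. \<phi> x \<noteq> 0}) \<and>
     (\<forall>k::int. \<phi> (of_int k) = (if k = 0 then 1 else 0)) \<and>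
     (\<forall>x. \<phi> x = (\<Sum>\<^sub>\<infinity>k::int. \<phi> (of_int k / 2) * \<phi> (2 * x - of_int k)))"

text \<open>
  An index \<open>s \<in> {0,1}\<^sup>n\<close> is a vector of type \<open>bool ^ 'n\<close>, with \<^const>\<open>False\<close> for \<open>0\<close> and \<^const>\<open>True\<close>
  for \<open>1\<close>.
\<close>

definition zero_index :: "bool ^ 'n" where
  "zero_index = (\<chi> i. False)"

definition \<zeta> :: "(real \<Rightarrow> 'k :: {real_normed_field, banach}) \<Rightarrow> bool \<Rightarrow> real \<Rightarrow> 'k" where
  "\<zeta> \<phi> r x = (if r then \<phi> (2 * x - 1) else \<phi> x)"

definition \<psi> ::
    "(real \<Rightarrow> 'k :: {real_normed_field, banach}) \<Rightarrow> bool ^ 'n \<Rightarrow> real ^ 'n \<Rightarrow> 'k" where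
  "\<psi> \<phi> s x = (\<Prod>i\<in>UNIV. \<zeta> \<phi> (s $ i) (x $ i))"

definition \<psi>_jk :: "(real \<Rightarrow> 'k :: {real_normed_field, banach})
    \<Rightarrow> bool ^ 'n \<Rightarrow> int \<Rightarrow> int ^ 'n \<Rightarrow> real ^ 'n \<Rightarrow> 'k" where
  "\<psi>_jk \<phi> s j k x = \<psi> \<phi> s (\<chi> i. 2 powi j * x $ i - of_int (k $ i))"

definition dual_filter1 :: "(real \<Rightarrow> 'k :: {real_normed_field, banach}) \<Rightarrow> bool \<Rightarrow> int \<Rightarrow> 'k" where
  "dual_filter1 \<phi> r l =
     (if r then (-1) powi (l - 1) * \<phi> ((1 - of_int l) / 2) else if l = 0 then 1 else 0)"

definition dual_filter ::
    "(real \<Rightarrow> 'k :: {real_normed_field, banach}) \<Rightarrow> bool ^ 'n \<Rightarrow> int ^ 'n \<Rightarrow> 'k" where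
  "dual_filter \<phi> s l = (\<Prod>i\<in>UNIV. dual_filter1 \<phi> (s $ i) (l $ i))"

text \<open>
  The sum defining \<open>dual_\<psi>\<close> has only finitely many nonzero terms, since \<open>\<phi>\<close> has compact support.
\<close>

definition dual_\<psi> ::
    "(real ^ 'n \<Rightarrow> 'k) set \<Rightarrow> (real \<Rightarrow> 'k :: {real_normed_field, banach})
      \<Rightarrow> bool ^ 'n \<Rightarrow> int \<Rightarrow> int ^ 'n \<Rightarrow> (real ^ 'n \<Rightarrow> 'k) \<Rightarrow> 'k" where
  "dual_\<psi> E \<phi> s j k = restrict (\<lambda>f. \<Sum>\<^sub>\<infinity>l::int ^ 'n.
     dual_filter \<phi> s l * f (\<chi> i. of_int (2 * k $ i + l $ i) / 2 powi (j + 1))) E"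

definition coeff_space ::
    "(real ^ 'n \<Rightarrow> 'k) set \<Rightarrow> (int ^ 'n \<Rightarrow> 'k :: {real_normed_field, banach}) set" where
  "coeff_space E = (if E = C_u then {a. bounded (range a)} else {a. (a \<longlongrightarrow> 0) cofinite})"

text \<open>For each \<open>x\<close> only finitely many terms of the sum over \<open>k\<close> are nonzero.\<close>

definition W_s :: "(real ^ 'n \<Rightarrow> 'k) set \<Rightarrow> (real \<Rightarrow> 'k :: {real_normed_field, banach})
    \<Rightarrow> bool ^ 'n \<Rightarrow> int \<Rightarrow> (real ^ 'n \<Rightarrow> 'k) set" where
  "W_s E \<phi> s j = {(\<lambda>x. \<Sum>\<^sub>\<infinity>k. a k * \<psi>_jk \<phi> s j k x) | a. a \<in> coeff_space E}"

definition V :: "(real ^ 'n \<Rightarrow> 'k) set \<Rightarrow> (real \<Rightarrow> 'k :: {real_normed_field, banach})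
    \<Rightarrow> int \<Rightarrow> (real ^ 'n \<Rightarrow> 'k) set" where
  "V E \<phi> j = W_s E \<phi> zero_index j"

text \<open>
  The direct sums below are internal ones, so the underlying set is the set of all sums. That the
  sums are direct is a consequence of the biorthogonality of the families \<^const>\<open>dual_\<psi>\<close> and
  \<^const>\<open>\<psi>_jk\<close> for fixed \<open>j\<close>.
\<close>

definition W :: "(real ^ 'n \<Rightarrow> 'k) set \<Rightarrow> (real \<Rightarrow> 'k :: {real_normed_field, banach})
    \<Rightarrow> int \<Rightarrow> (real ^ 'n \<Rightarrow> 'k) set" where
  "W E \<phi> j = {(\<lambda>x. \<Sum>s\<in>UNIV - {zero_index}. w s x) | w.
     \<forall>s\<in>UNIV - {zero_index}. w s \<in> W_s E \<phi> s j}"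

text \<open>
  The series converges absolutely in the dual of \<open>E\<close> for every summable family \<open>d\<close>, because the norms
  of the functionals \<open>dual_\<psi> E \<phi> s j k\<close> are bounded uniformly in \<open>k\<close>.
\<close>

definition dual_W_s :: "(real ^ 'n \<Rightarrow> 'k) set \<Rightarrow> (real \<Rightarrow> 'k :: {real_normed_field, banach})
    \<Rightarrow> bool ^ 'n \<Rightarrow> int \<Rightarrow> ((real ^ 'n \<Rightarrow> 'k) \<Rightarrow> 'k) set" where
  "dual_W_s E \<phi> s j = {b. \<exists>d. (\<lambda>k. norm (d k)) summable_on UNIV \<and>
     dual_has_sum E (\<lambda>k f. d k * dual_\<psi> E \<phi> s j k f) b}"

definition dual_V :: "(real ^ 'n \<Rightarrow> 'k) set \<Rightarrow> (real \<Rightarrow> 'k :: {real_normed_field, banach})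
    \<Rightarrow> int \<Rightarrow> ((real ^ 'n \<Rightarrow> 'k) \<Rightarrow> 'k) set" where
  "dual_V E \<phi> j = dual_W_s E \<phi> zero_index j"

definition dual_W :: "(real ^ 'n \<Rightarrow> 'k) set \<Rightarrow> (real \<Rightarrow> 'k :: {real_normed_field, banach})
    \<Rightarrow> int \<Rightarrow> ((real ^ 'n \<Rightarrow> 'k) \<Rightarrow> 'k) set" where
  "dual_W E \<phi> j = {restrict (\<lambda>f. \<Sum>s\<in>UNIV - {zero_index}. w s f) E | w.
     \<forall>s\<in>UNIV - {zero_index}. w s \<in> dual_W_s E \<phi> s j}"

end

theory Submission
  imports Defs
begin

text \<open>
  Everything reduces to one-dimensional pairings. A functional \<open>dual_\<psi> E \<phi> s j k\<close> is a finite
  combination of point evaluations, and both its coefficients and the functions \<open>\<psi>_jk \<phi> t j' m\<close> are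
  tensor products; hence the value of the one on the other is the product over the coordinates \<open>i\<close>
  of numbers \<open>pairing (s $ i) (t $ i) (j' - j) (k $ i) (m $ i)\<close> (lemma \<open>dual_psi_psi\<close>). Such a
  product vanishes as soon as one factor does, so the orthogonality relations follow from vanishing in
  a single coordinate, and their sharpness from a choice of shifts that makes all factors nonzero.

  On the line there are two reasons for vanishing.

  \<^item> The functions \<open>\<phi>(2 \<cdot> - 1)\<close> are zero at all integers, because \<open>\<phi>\<close> is zero at the odd ones.
    The functional of scale \<open>j\<close> of type \<open>0\<close> evaluates at \<open>2\<^sup>-\<^sup>j\<int>\<close>, and that of type \<open>1\<close> at
    \<open>2\<^sup>-\<^sup>j\<^sup>-\<^sup>1\<int>\<close>, so they annihilate the wavelets \<open>\<phi>(2 \<cdot> - 1)\<close> of scales \<open>j' \<ge> j\<close> and \<open>j' > j\<close>, respectively.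
  \<^item> The high-pass filter \<open>(-1)\<^sup>l\<^sup>-\<^sup>1 \<phi>((1 - l)/2)\<close> annihilates the integer shifts of \<open>\<phi>\<close>:
    only one odd and one even index contribute, with opposite signs
    (\<open>high_pass_annihilates_shift\<close>). By the refinement equation, coarser scaling functions are
    combinations of these shifts and are annihilated, too (\<open>high_pass_annihilates_coarse\<close>). A
    wavelet \<open>\<phi>(2 \<cdot> - 1)\<close> is a scaling function of the next finer scale, so it is annihilated by
    functionals of type \<open>1\<close> and strictly finer scale.

  It remains to pass from the basis functions to the spaces. A wavelet series with coefficients in
  \<open>coeff_space E\<close> is a sum of boundedly many terms near each point, which shows that it belongs to
  \<open>E\<close> (\<open>wavelet_series_mem_E\<close>) and that finite combinations of point evaluations may be exchanged
  with the sum (\<open>dual_psi_wavelet_series\<close>). On the dual side, norm convergence implies pointwise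
  convergence, so a functional given by a series vanishes wherever all terms do
  (\<open>dual_has_sum_zero\<close>).
\<close>

section \<open>The function spaces and their duals\<close>

lemma bounded_range_E:
  fixes f :: "real ^ 'n \<Rightarrow> 'k :: {real_normed_field, banach}"
  assumes "E = C_u \<or> E = C_0" "f \<in> E"
  shows "bounded (range f)"
proof (cases "E = C_u")
  case True
  then show ?thesis using assms by (simp add: C_u_def)
next
  case False
  then have cont: "continuous_on UNIV f" and lim: "(f \<longlongrightarrow> 0) at_infinity"
    using assms by (auto simp: C_0_def)
  from lim have "\<forall>\<^sub>F x in at_infinity. norm (f x) < 1"
    using tendstoD[of f 0 at_infinity 1] by simp
  then obtain b where b: "\<And>x. b \<le> norm x \<Longrightarrow> norm (f x) < 1"
    by (auto simp: eventually_at_infinity)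
  have "bounded (f ` cball 0 b)"
    using cont by (intro compact_imp_bounded compact_continuous_image)
      (auto intro: continuous_on_subset)
  then have "bounded (f ` cball 0 b \<union> ball 0 1)" by simp
  moreover have "f x \<in> f ` cball 0 b \<union> ball 0 1" for x
    using b[of x] by (cases "b \<le> norm x") auto
  then have "range f \<subseteq> f ` cball 0 b \<union> ball 0 1" by blast
  ultimately show ?thesis by (rule bounded_subset)
qed

lemma norm_le_sup_norm: "norm (f x) \<le> sup_norm f" if "bounded (range f)"
proof -
  have "bdd_above (range (\<lambda>x. norm (f x)))"
    using that by (auto simp: bounded_iff bdd_above_def)
  then show ?thesis unfolding sup_norm_def by (rule cSUP_upper[rotated]) simp
qed

lemma sup_norm_nonneg: "0 \<le> sup_norm f" if "bounded (range f)"
  using norm_le_sup_norm[OF that] norm_ge_zero order_trans by blast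

lemma sup_norm_scale_le:
  fixes f :: "'a \<Rightarrow> 'k :: real_normed_field"
  assumes "bounded (range f)"
  shows "sup_norm (\<lambda>x. c * f x) \<le> norm c * sup_norm f"
  unfolding sup_norm_def[of "\<lambda>x. c * f x"]
  by (rule cSUP_least) (auto simp: norm_mult intro!: mult_left_mono norm_le_sup_norm assms)

lemma zero_mem_E:
  assumes "E = C_u \<or> E = C_0" shows "(\<lambda>x. 0) \<in> E"
  using assms by (auto simp: C_u_def C_0_def intro!: uniformly_continuous_on_const)

lemma add_mem_E:
  assumes "E = C_u \<or> E = C_0" "f \<in> E" "g \<in> E" shows "(\<lambda>x. f x + g x) \<in> E"
  using assms by (auto simp: C_u_def C_0_def bounded_plus_comp
      intro!: uniformly_continuous_on_add continuous_on_add tendsto_add_zero)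

lemma scale_mem_E:
  fixes c :: "'k :: {real_normed_field, banach}"
  assumes "E = C_u \<or> E = C_0" "f \<in> E" shows "(\<lambda>x. c * f x) \<in> E"
proof -
  have "bounded (range (\<lambda>x. c * f x))" if "bounded (range f)"
    using bounded_linear_image[OF that bounded_linear_mult_right[of c]] by (simp add: image_image)
  then show ?thesis using assms
    by (auto simp: C_u_def C_0_def intro!: continuous_intros tendsto_mult_right_zero
        bounded_linear.uniformly_continuous_on[OF bounded_linear_mult_right])
qed

lemma dual_zero:
  assumes "E = C_u \<or> E = C_0"
  shows "restrict (\<lambda>f. 0) E \<in> dual E"
  using add_mem_E[OF assms] scale_mem_E[OF assms] by (auto simp: dual_def intro: exI[of _ 0])

text \<open>
  Convergence in the dual norm implies pointwise convergence: after scaling \<open>f\<close> to norm one, the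
  value of a functional at \<open>f\<close> is bounded by its norm. Since \<open>dual_norm\<close> is a supremum of real numbers,
  this bound requires the functional to be bounded on the unit ball.
\<close>

lemma dual_has_sum_zero:
  fixes v :: "'i \<Rightarrow> (real ^ 'n \<Rightarrow> 'k :: {real_normed_field, banach}) \<Rightarrow> 'k"
  assumes E: "E = C_u \<or> E = C_0" and v: "\<And>k. v k \<in> dual E" and b: "dual_has_sum E (\<lambda>k f. d k * v k f) b"
    and f: "f \<in> E" and vf: "\<And>k. v k f = 0"
  shows "b f = 0"
proof -
  have bE: "b \<in> dual E" using b by (simp add: dual_has_sum_def)
  obtain C where C: "\<And>f. f \<in> E \<Longrightarrow> norm (b f) \<le> C * sup_norm f"
    using bE unfolding dual_def by blast
  note bounded = bounded_range_E[OF E]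
  show ?thesis
  proof (cases "sup_norm f = 0")
    case True
    then show ?thesis using C[OF f] by simp
  next
    case False
    define c :: 'k where "c = of_real (1 / sup_norm f)"
    define g where "g = (\<lambda>x. c * f x)"
    have c: "c \<noteq> 0" "norm c * sup_norm f = 1"
      using False sup_norm_nonneg[OF bounded[OF f]] by (auto simp: c_def norm_divide)
    have g: "g \<in> E" "sup_norm g \<le> 1"
      using scale_mem_E[OF E f] sup_norm_scale_le[OF bounded[OF f], of c] c by (auto simp: g_def)
    have vg: "v k g = 0" for k
      using v[of k] vf f unfolding g_def dual_def by auto
    have "norm (b g) \<le> dual_norm E (\<lambda>f. b f - (\<Sum>k\<in>F. d k * v k f))" if "finite F" for F
    proof -
      have "\<exists>C. \<forall>f\<in>E. norm (v k f) \<le> C * sup_norm f" for k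
        using v[of k] by (auto simp: dual_def)
      then obtain D where D: "\<And>k f. f \<in> E \<Longrightarrow> norm (v k f) \<le> D k * sup_norm f" by metis
      have "norm (b h - (\<Sum>k\<in>F. d k * v k h)) \<le> \<bar>C\<bar> + (\<Sum>k\<in>F. norm (d k) * \<bar>D k\<bar>)"
        if h: "h \<in> E" "sup_norm h \<le> 1" for h
      proof -
        have le: "x * sup_norm h \<le> \<bar>x\<bar>" for x
          using mult_mono[of x "\<bar>x\<bar>" "sup_norm h" 1] h sup_norm_nonneg[OF bounded[OF h(1)]] by simp
        have "norm (b h) \<le> \<bar>C\<bar>" using C[OF h(1)] le order_trans by blast
        moreover have "norm (\<Sum>k\<in>F. d k * v k h) \<le> (\<Sum>k\<in>F. norm (d k) * \<bar>D k\<bar>)"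
          by (rule sum_norm_le)
            (auto simp: norm_mult intro!: mult_left_mono order_trans[OF D[OF h(1)] le])
        ultimately show ?thesis
          using norm_triangle_ineq4[of "b h" "\<Sum>k\<in>F. d k * v k h"] by linarith
      qed
      then have "bdd_above ((\<lambda>f. norm (b f - (\<Sum>k\<in>F. d k * v k f))) ` {f \<in> E. sup_norm f \<le> 1})"
        by (auto intro!: bdd_aboveI)
      then have "norm (b g - (\<Sum>k\<in>F. d k * v k g)) \<le> dual_norm E (\<lambda>f. b f - (\<Sum>k\<in>F. d k * v k f))"
        unfolding dual_norm_def using g by (intro cSUP_upper) auto
      then show ?thesis by (simp add: vg)
    qed
    then have "norm (b g) \<le> 0"
      using b unfolding dual_has_sum_def
      by (intro tendsto_lowerbound[of _ 0 "finite_subsets_at_top UNIV"])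
        (auto intro!: eventually_finite_subsets_at_top_weakI)
    moreover have "b g = c * b f" using bE f by (auto simp: dual_def g_def)
    ultimately show ?thesis using c by simp
  qed
qed

text \<open>
  For finite \<open>F\<close> containing \<open>k\<close>, the difference between \<open>b\<close> and the partial sum over \<open>F\<close> vanishes on
  \<open>E\<close>, and \<open>dual_norm\<close> sees functionals on \<open>E\<close> only. The cases used are a single dual wavelet and
  the zero functional.
\<close>

lemma dual_has_sum_single:
  fixes v :: "'i \<Rightarrow> (real ^ 'n \<Rightarrow> 'k :: {real_normed_field, banach}) \<Rightarrow> 'k"
  assumes E: "E = C_u \<or> E = C_0" and b: "b \<in> dual E"
    and eq: "\<And>f. f \<in> E \<Longrightarrow> b f = d k * v k f" and d: "\<And>k'. k' \<noteq> k \<Longrightarrow> d k' = 0"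
  shows "dual_has_sum E (\<lambda>k f. d k * v k f) b"
proof -
  have "dual_norm E (\<lambda>f. b f - (\<Sum>k\<in>F. d k * v k f)) = 0" if F: "finite F" "{k} \<subseteq> F" for F
  proof -
    have "(\<Sum>k\<in>F. d k * v k f) = d k * v k f" for f
    proof -
      have "(\<Sum>k\<in>F. d k * v k f) = (\<Sum>k\<in>{k}. d k * v k f)"
        using F d by (intro sum.mono_neutral_right) auto
      then show ?thesis by simp
    qed
    then have "(\<lambda>f. norm (b f - (\<Sum>k\<in>F. d k * v k f))) ` {f \<in> E. sup_norm f \<le> 1}
        = (\<lambda>f. 0) ` {f \<in> E. sup_norm f \<le> 1}"
      by (intro image_cong) (auto simp: eq)
    moreover have "(\<lambda>x. 0) \<in> {f \<in> E. sup_norm f \<le> 1}"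
      using zero_mem_E[OF E] by (simp add: sup_norm_def)
    then have "{f \<in> E. sup_norm f \<le> 1} \<noteq> {}" by blast
    ultimately show ?thesis unfolding dual_norm_def by simp
  qed
  then have "\<forall>\<^sub>F F in finite_subsets_at_top UNIV. dual_norm E (\<lambda>f. b f - (\<Sum>k\<in>F. d k * v k f)) = 0"
    unfolding eventually_finite_subsets_at_top by (intro exI[of _ "{k}"]) auto
  then show ?thesis
    using b unfolding dual_has_sum_def by (auto intro: tendsto_eventually)
qed

text \<open>
  The two conclusions are proved by a joint induction because additivity of \<open>b\<close> is available only for
  arguments in \<open>E\<close>.
\<close>

lemma dual_additive_sum:
  assumes E: "E = C_u \<or> E = C_0" and b: "b \<in> dual E" and I: "finite I" "\<And>i. i \<in> I \<Longrightarrow> w i \<in> E"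
  shows "(\<lambda>x. \<Sum>i\<in>I. w i x) \<in> E \<and> b (\<lambda>x. \<Sum>i\<in>I. w i x) = (\<Sum>i\<in>I. b (w i))"
  using I
proof (induction I rule: finite_induct)
  case empty
  have "\<forall>c. \<forall>f\<in>E. b (\<lambda>x. c * f x) = c * b f"
    using b unfolding dual_def by blast
  from this[rule_format, OF zero_mem_E[OF E], of 0] show ?case
    using zero_mem_E[OF E] by simp
next
  case (insert i I)
  then show ?case using b add_mem_E[OF E] by (simp add: dual_def)
qed

section \<open>Pairings on the line\<close>

text \<open>
  The support of the scaling function is controlled by a fixed integer radius \<open>R\<close>, so that the
  filters and the wavelets near a point have explicit finite index sets.
\<close>

locale mother_scaling =
  fixes \<phi> :: "real \<Rightarrow> 'k :: {real_normed_field, banach}" and R :: int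
  assumes mother: "mother_scaling_function \<phi>"
    and support: "real_of_int R < \<bar>x\<bar> \<Longrightarrow> \<phi> x = 0"
begin

lemma continuous_phi: "continuous_on A \<phi>"
  using mother continuous_on_subset unfolding mother_scaling_function_def by blast

lemma phi_int: "\<phi> (of_int k) = (if k = 0 then 1 else 0)"
  using mother unfolding mother_scaling_function_def by blast

lemma phi_0: "\<phi> 0 = 1"
  using phi_int[of 0] by simp

lemma radius_nonneg: "0 \<le> R"
  using support[of 0] phi_0 by force

lemma refinement: "\<phi> x = (\<Sum>k\<in>{-2*R..2*R}. \<phi> (of_int k / 2) * \<phi> (2 * x - of_int k))"
proof -
  have "\<phi> (of_int k / 2) = 0" if "k \<notin> {-2*R..2*R}" for k :: int
    by (rule support) (use that in \<open>auto simp: abs_if\<close>)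
  then have "(\<Sum>\<^sub>\<infinity>k::int. \<phi> (of_int k / 2) * \<phi> (2 * x - of_int k))
      = (\<Sum>\<^sub>\<infinity>k\<in>{-2*R..2*R}. \<phi> (of_int k / 2) * \<phi> (2 * x - of_int k))"
    by (intro infsum_cong_neutral) auto
  moreover have "\<phi> x = (\<Sum>\<^sub>\<infinity>k::int. \<phi> (of_int k / 2) * \<phi> (2 * x - of_int k))"
    using mother unfolding mother_scaling_function_def by blast
  ultimately show ?thesis
    by (metis infsum_finite finite_atLeastAtMost_int)
qed

definition filter_support :: "int set" where
  "filter_support = {-2*R-1..2*R+1}"

lemma finite_filter_support [simp]: "finite filter_support"
  by (simp add: filter_support_def)

lemma small_in_filter_support [simp]: "0 \<in> filter_support" "1 \<in> filter_support"
  using radius_nonneg by (auto simp: filter_support_def)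

lemma dual_filter1_eq_0: "dual_filter1 \<phi> r l = 0" if "l \<notin> filter_support"
proof -
  have "2 * R + 1 < l \<or> l < - 2 * R - 1"
    using that by (auto simp: filter_support_def)
  then have "real_of_int (2 * R + 1) < of_int l \<or> real_of_int l < of_int (- 2 * R - 1)"
    by (simp only: of_int_less_iff)
  then have "real_of_int R < \<bar>(1 - of_int l) / 2\<bar>"
    by (auto simp: abs_if field_simps)
  then have "\<phi> ((1 - of_int l) / 2) = 0"
    by (rule support)
  moreover have "l \<noteq> 0"
    using that by (metis small_in_filter_support(1))
  ultimately show ?thesis
    by (simp add: dual_filter1_def)
qed

text \<open>
  This is the value of the one-dimensional dual wavelet of type \<open>r\<close>, scale \<open>j\<close> and shift \<open>q\<close> on the
  wavelet of type \<open>t\<close>, scale \<open>j + e\<close> and shift \<open>c\<close>; it depends on the two scales through their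
  difference \<open>e\<close> only.
\<close>

definition pairing :: "bool \<Rightarrow> bool \<Rightarrow> int \<Rightarrow> int \<Rightarrow> int \<Rightarrow> 'k" where
  "pairing r t e q c = (\<Sum>l\<in>filter_support. dual_filter1 \<phi> r l *
     \<zeta> \<phi> t (2 powi e * (of_int q + of_int l / 2) - of_int c))"

lemma pairing_False: "pairing False t e q c = \<zeta> \<phi> t (2 powi e * of_int q - of_int c)"
proof -
  have "pairing False t e q c = (\<Sum>l\<in>{0}. dual_filter1 \<phi> False l *
     \<zeta> \<phi> t (2 powi e * (of_int q + of_int l / 2) - of_int c))"
    unfolding pairing_def
    by (intro sum.mono_neutral_right) (auto simp: dual_filter1_def)
  then show ?thesis by (simp add: dual_filter1_def)
qed

text \<open>
  In the sum over \<open>l\<close>, an odd \<open>l\<close> contributes only if the filter argument \<open>(1 - l)/2\<close> is \<open>0\<close>, and an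
  even \<open>l\<close> only if the evaluation point \<open>l/2 + q\<close> is \<open>0\<close>. The two contributions are \<open>\<phi>(1/2 + q)\<close>
  and its negative.
\<close>

lemma high_pass_annihilates_shift:
  "(\<Sum>l\<in>filter_support. dual_filter1 \<phi> True l * \<phi> (of_int l / 2 + of_int q)) = 0"
proof -
  let ?t = "\<lambda>l. dual_filter1 \<phi> True l * \<phi> (of_int l / 2 + of_int q)"
  have zero: "?t l = 0" if "l \<noteq> 1" "l \<noteq> -2*q" for l
  proof (cases "even l")
    case True
    then obtain m where m: "l = 2*m" by (auto elim: evenE)
    have "real_of_int l / 2 + of_int q = of_int (m + q)" using m by simp
    then have "\<phi> (of_int l / 2 + of_int q) = 0" using phi_int[of "m + q"] that m by simp
    then show ?thesis by simp
  next
    case False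
    then obtain m where m: "l = 2*m+1" by (auto elim: oddE)
    have "(1 - real_of_int l) / 2 = of_int (-m)" using m by simp
    then show ?thesis using phi_int[of "-m"] that m by (simp add: dual_filter1_def)
  qed
  \<comment> \<open>The index \<open>-2 * q\<close> may lie outside of \<open>filter_support\<close>; then the filter vanishes there.\<close>
  have "sum ?t filter_support = sum ?t {1, -2*q}"
    by (rule sum.mono_neutral_cong) (auto simp: zero dual_filter1_eq_0)
  also have "\<dots> = ?t 1 + ?t (-2*q)"
    by (subst sum.insert) (auto, presburger)
  also have "?t 1 = \<phi> (1/2 + of_int q)"
    by (simp add: dual_filter1_def phi_0)
  also have "?t (-2*q) = - \<phi> (1/2 + of_int q)"
  proof -
    have "odd (-2*q - 1)" by simp
    then have "(-1 :: 'k) powi (-2*q - 1) = -1"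
      by (subst power_int_minus_left_odd) auto
    moreover have "(1 - real_of_int (-2*q)) / 2 = 1/2 + of_int q"
      by (simp add: add_divide_distrib)
    ultimately show ?thesis
      by (simp only: dual_filter1_def if_True) (simp add: phi_0)
  qed
  finally show ?thesis by simp
qed

text \<open>
  The refinement equation writes a dilate by \<open>2\<^sup>e\<^sup>+\<^sup>1\<close> as a combination of integer shifts of the
  dilate by \<open>2\<^sup>e\<close>, which keep the form of the statement with \<open>q\<close> replaced by \<open>q - 2\<^sup>e k\<close>. This is why
  the induction is over all \<open>q\<close>.
\<close>

lemma high_pass_annihilates_coarse:
  "(\<Sum>l\<in>filter_support. dual_filter1 \<phi> True l * \<phi> ((of_int l / 2 + of_int q) / 2 ^ e)) = 0"
proof (induction e arbitrary: q)
  case 0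
  show ?case using high_pass_annihilates_shift by simp
next
  case (Suc e)
  have "\<phi> ((of_int l / 2 + of_int q) / 2 ^ Suc e)
      = (\<Sum>k\<in>{-2*R..2*R}. \<phi> (of_int k / 2) * \<phi> ((of_int l / 2 + of_int (q - 2^e * k)) / 2 ^ e))"
    for l
  proof -
    have "2 * ((of_int l / 2 + of_int q) / 2 ^ Suc e) - of_int k
       = (of_int l / 2 + of_int (q - 2^e * k)) / (2 ^ e :: real)" for k
      by (simp add: field_simps)
    then show ?thesis by (subst refinement) (simp only:)
  qed
  then have "(\<Sum>l\<in>filter_support. dual_filter1 \<phi> True l * \<phi> ((of_int l / 2 + of_int q) / 2 ^ Suc e))
      = (\<Sum>l\<in>filter_support. \<Sum>k\<in>{-2*R..2*R}. \<phi> (of_int k / 2) *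
          (dual_filter1 \<phi> True l * \<phi> ((of_int l / 2 + of_int (q - 2^e * k)) / 2 ^ e)))"
    by (simp only: sum_distrib_left mult.left_commute)
  also have "\<dots> = (\<Sum>k\<in>{-2*R..2*R}. \<phi> (of_int k / 2) * (\<Sum>l\<in>filter_support.
          dual_filter1 \<phi> True l * \<phi> ((of_int l / 2 + of_int (q - 2^e * k)) / 2 ^ e)))"
    by (subst sum.swap) (simp only: sum_distrib_left)
  also have "\<dots> = 0"
    by (simp only: Suc.IH) simp
  finally show ?case .
qed

lemma pairing_True_False: "pairing True False e q c = 0" if "e \<le> 0"
proof -
  define n where "n = nat (- e)"
  have e: "e = - int n" using that by (simp add: n_def)
  have "2 powi e * (of_int q + of_int l / 2) - of_int c
      = (of_int l / 2 + of_int (q - 2^n * c)) / (2 ^ n :: real)" for l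
    by (simp add: e power_int_minus field_simps)
  then show ?thesis
    using high_pass_annihilates_coarse[of "q - 2^n * c" n] by (simp add: pairing_def \<zeta>_def)
qed

text \<open>
  \<open>\<phi>(2(2\<^sup>e x - c) - 1) = \<phi>(2\<^sup>e\<^sup>+\<^sup>1 x - (2c + 1))\<close>, so a wavelet is a scaling function of the
  next scale, which is still not finer than the functional if \<open>e < 0\<close>.
\<close>

lemma pairing_True_True_coarse: "pairing True True e q c = 0" if "e < 0"
proof -
  have "\<zeta> \<phi> True (2 powi e * (of_int q + of_int l / 2) - of_int c)
     = \<zeta> \<phi> False (2 powi (e+1) * (of_int q + of_int l / 2) - of_int (2*c+1))" for l
    by (simp add: \<zeta>_def power_int_add algebra_simps)
  then have "pairing True True e q c = pairing True False (e+1) q (2*c+1)"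
    by (simp add: pairing_def)
  then show ?thesis using pairing_True_False[of "e+1"] that by simp
qed

lemma zeta_True_int: "\<zeta> \<phi> True (of_int m) = 0"
proof -
  have "2*m - 1 \<noteq> 0" by presburger
  then show ?thesis using phi_int[of "2*m-1"] by (simp add: \<zeta>_def)
qed

lemma pairing_False_True: "pairing False True e q c = 0" if "0 \<le> e"
proof -
  have "2 powi e * of_int q - of_int c = (of_int (2 ^ nat e * q - c) :: real)"
    using that by (simp add: power_int_def)
  then show ?thesis using zeta_True_int by (simp only: pairing_False)
qed

text \<open>
  For \<open>e > 0\<close> the half-integer grid of the functional is mapped to integers, where the wavelet
  vanishes, whatever the filter is.
\<close>

lemma pairing_True_fine: "pairing r True e q c = 0" if "0 < e"
proof -
  have "2 powi e * (of_int q + of_int l / 2) - of_int c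
      = (of_int (2 ^ nat (e-1) * (2*q+l) - c) :: real)" for l
  proof -
    have "(2::real) powi e = 2 ^ nat (e-1) * 2" 
      using that power_int_add[of "2::real" "e-1" 1] by (auto simp: power_int_def)
    then show ?thesis by (simp add: algebra_simps)
  qed
  then show ?thesis using zeta_True_int by (simp only: pairing_def) simp
qed

lemma pairing_diagonal: "pairing r r 0 0 0 = 1"
proof (cases r)
  case True
  have "pairing True True 0 0 0 = (\<Sum>l\<in>{1}. dual_filter1 \<phi> True l *
     \<zeta> \<phi> True (2 powi 0 * (of_int 0 + of_int l / 2) - of_int 0))"
    unfolding pairing_def
  proof (intro sum.mono_neutral_right ballI)
    fix l assume "l \<in> filter_support - {1}"
    then show "dual_filter1 \<phi> True l * \<zeta> \<phi> True (2 powi 0 * (of_int 0 + of_int l / 2) - of_int 0) = 0"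
      using phi_int[of "l-1"] by (simp add: \<zeta>_def)
  qed auto
  then show ?thesis using True by (simp add: dual_filter1_def \<zeta>_def phi_0)
qed (simp add: pairing_False \<zeta>_def phi_0)

text \<open>
  The shift is chosen such that the evaluation points become \<open>2\<^sup>e\<^sup>-\<^sup>1(l - 1)\<close>: at these integers
  \<open>\<phi>\<close> vanishes unless \<open>l = 1\<close>.
\<close>

lemma pairing_True_False_witness: "pairing True False e 0 (2 ^ nat (e-1)) = 1" if "0 < e"
proof -
  have eq: "2 powi e * (of_int 0 + of_int l / 2) - of_int (2 ^ nat (e-1))
      = (of_int (2 ^ nat (e-1) * (l-1)) :: real)" for l
  proof -
    have "(2::real) powi e = 2 ^ nat (e-1) * 2" 
      using that power_int_add[of "2::real" "e-1" 1] by (auto simp: power_int_def)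
    then show ?thesis by (simp add: algebra_simps)
  qed
  have "pairing True False e 0 (2 ^ nat (e-1)) = (\<Sum>l\<in>{1}. dual_filter1 \<phi> True l *
     \<zeta> \<phi> False (of_int (2 ^ nat (e-1) * (l-1))))"
    unfolding pairing_def eq
  proof (intro sum.mono_neutral_right ballI)
    fix l assume "l \<in> filter_support - {1}"
    then show "dual_filter1 \<phi> True l * \<zeta> \<phi> False (of_int (2 ^ nat (e-1) * (l-1))) = 0"
      using phi_int[of "2 ^ nat (e-1) * (l-1)"] by (simp add: \<zeta>_def)
  qed auto
  then show ?thesis by (simp add: dual_filter1_def \<zeta>_def phi_0)
qed

text \<open>
  The shift puts the only evaluation point at \<open>1/2\<close>, where \<open>\<phi>(2 \<cdot> - 1)\<close> takes the value
  \<open>\<phi>(0) = 1\<close>.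
\<close>

lemma pairing_False_True_witness: "pairing False True e (2 ^ nat (-e-1)) 0 = 1" if "e < 0"
proof -
  have "(2::real) powi e * 2 ^ nat (-e-1) = 2 powi e * 2 powi (-e-1)"
    using that by (simp add: power_int_def)
  also have "\<dots> = 2 powi (-1)"
    by (subst power_int_add [symmetric]) auto
  finally have "(2::real) powi e * 2 ^ nat (-e-1) = 1/2" by (simp add: power_int_minus)
  then have "2 * ((2::real) powi e * of_int (2 ^ nat (-e-1)) - of_int 0) - 1 = 0" by simp
  then show ?thesis unfolding pairing_False \<zeta>_def by (simp only: if_True phi_0)
qed

section \<open>Tensor products\<close>

definition vec_box :: "int set \<Rightarrow> (int ^ 'n) set" where
  "vec_box B = {l. \<forall>i. l $ i \<in> B}"

lemma finite_vec_box: "finite B \<Longrightarrow> finite (vec_box B :: (int ^ 'n) set)"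
proof -
  assume "finite B"
  then have "finite (vec_lambda ` (UNIV \<rightarrow>\<^sub>E B) :: (int ^ 'n) set)"
    by (intro finite_imageI finite_PiE) auto
  moreover have "vec_box B \<subseteq> (vec_lambda ` (UNIV \<rightarrow>\<^sub>E B) :: (int ^ 'n) set)"
    by (auto simp: vec_box_def intro!: image_eqI[where x = "vec_nth _"])
  ultimately show ?thesis by (rule rev_finite_subset)
qed

text \<open>
  The distributive law that splits a multi-index sum of a tensor product into one-dimensional sums.
\<close>

lemma sum_vec_box_prod:
  fixes h :: "'n::finite \<Rightarrow> int \<Rightarrow> 'k"
  assumes "finite B"
  shows "(\<Sum>l\<in>vec_box B. \<Prod>i\<in>UNIV. h i (l $ i)) = (\<Prod>i\<in>UNIV. \<Sum>l\<in>B. h i l)"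
proof -
  have "(\<Prod>i\<in>UNIV. \<Sum>l\<in>B. h i l) = (\<Sum>g\<in>UNIV \<rightarrow>\<^sub>E B. \<Prod>i\<in>UNIV. h i (g i))"
    using assms by (intro prod_sum_PiE) auto
  also have "\<dots> = (\<Sum>l\<in>vec_box B. \<Prod>i\<in>UNIV. h i (l $ i))"
    by (rule sum.reindex_bij_witness[where i = vec_nth and j = vec_lambda])
      (auto simp: vec_box_def)
  finally show ?thesis by simp
qed

lemma dual_filter_eq_0: "dual_filter \<phi> s l = 0" if l: "l \<notin> vec_box filter_support"
proof -
  obtain i where "l $ i \<notin> filter_support" using l unfolding vec_box_def by blast
  then have "dual_filter1 \<phi> (s $ i) (l $ i) = 0" by (rule dual_filter1_eq_0)
  then show ?thesis unfolding dual_filter_def by (intro prod_zero) auto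
qed

lemma dual_psi_eq_sum:
  assumes "f \<in> E"
  shows "dual_\<psi> E \<phi> s j k f = (\<Sum>l\<in>vec_box filter_support.
     dual_filter \<phi> s l * f (\<chi> i. of_int (2 * k $ i + l $ i) / 2 powi (j + 1)))"
proof -
  have "(\<Sum>\<^sub>\<infinity>l. dual_filter \<phi> s l * f (\<chi> i. of_int (2 * k $ i + l $ i) / 2 powi (j + 1)))
    = (\<Sum>\<^sub>\<infinity>l\<in>vec_box filter_support.
     dual_filter \<phi> s l * f (\<chi> i. of_int (2 * k $ i + l $ i) / 2 powi (j + 1)))"
    by (intro infsum_cong_neutral) (auto simp: dual_filter_eq_0)
  then show ?thesis
    using assms by (simp add: dual_\<psi>_def infsum_finite[OF finite_vec_box[OF finite_filter_support]])
qed

lemma dual_psi_psi: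
  "(\<Sum>l\<in>vec_box filter_support. dual_filter \<phi> s l *
      \<psi>_jk \<phi> t j' m (\<chi> i. of_int (2 * k $ i + l $ i) / 2 powi (j + 1)))
    = (\<Prod>i\<in>UNIV. pairing (s $ i) (t $ i) (j' - j) (k $ i) (m $ i))"
proof -
  have arg: "2 powi j' * (of_int (2 * q + l) / 2 powi (j + 1))
     = 2 powi (j' - j) * (of_int q + of_int l / 2 :: real)" for q l
    by (simp add: power_int_diff power_int_add field_simps)
  have "dual_filter \<phi> s l * \<psi>_jk \<phi> t j' m (\<chi> i. of_int (2 * k $ i + l $ i) / 2 powi (j + 1))
    = (\<Prod>i\<in>UNIV. dual_filter1 \<phi> (s $ i) (l $ i) * \<zeta> \<phi> (t $ i)
         (2 powi (j' - j) * (of_int (k $ i) + of_int (l $ i) / 2) - of_int (m $ i)))" for l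
    by (simp only: dual_filter_def \<psi>_jk_def \<psi>_def prod.distrib vec_lambda_beta arg)
  then show ?thesis
    unfolding pairing_def by (simp only:) (rule sum_vec_box_prod, simp)
qed

lemma dual_psi_mem_dual:
  assumes E: "E = C_u \<or> E = C_0"
  shows "dual_\<psi> E \<phi> s j k \<in> dual E"
proof -
  let ?p = "\<lambda>l. \<chi> i. real_of_int (2 * k $ i + l $ i) / 2 powi (j + 1)"
  let ?C = "\<Sum>l\<in>vec_box filter_support. norm (dual_filter \<phi> s l)"
  have "norm (dual_\<psi> E \<phi> s j k f) \<le> ?C * sup_norm f" if f: "f \<in> E" for f
    unfolding dual_psi_eq_sum[OF f] sum_distrib_right
    by (rule sum_norm_le)
      (auto simp: norm_mult intro!: mult_left_mono norm_le_sup_norm bounded_range_E[OF E f])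
  moreover have "dual_\<psi> E \<phi> s j k \<in> extensional E"
    by (simp add: dual_\<psi>_def)
  moreover have "dual_\<psi> E \<phi> s j k (\<lambda>x. f x + g x) = dual_\<psi> E \<phi> s j k f + dual_\<psi> E \<phi> s j k g"
    if "f \<in> E" "g \<in> E" for f g
    using that add_mem_E[OF E that] by (simp add: dual_psi_eq_sum distrib_left sum.distrib)
  moreover have "dual_\<psi> E \<phi> s j k (\<lambda>x. c * f x) = c * dual_\<psi> E \<phi> s j k f"
    if "f \<in> E" for c f
    using that scale_mem_E[OF E that, of c]
    by (simp add: dual_psi_eq_sum sum_distrib_left mult.left_commute)
  ultimately show ?thesis unfolding dual_def by blast
qed

section \<open>Wavelet series\<close>

lemma zeta_support: "\<bar>x\<bar> \<le> R + 1" if "\<zeta> \<phi> r x \<noteq> 0"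
proof -
  have "\<bar>if r then 2 * x - 1 else x\<bar> \<le> R"
    using that support unfolding \<zeta>_def by (metis linorder_not_le)
  then show ?thesis using radius_nonneg by (auto split: if_splits)
qed

lemma psi_support: "\<bar>x $ i\<bar> \<le> R + 1" if "\<psi> \<phi> s x \<noteq> 0"
proof -
  have "\<zeta> \<phi> (s $ i) (x $ i) \<noteq> 0"
    using that unfolding \<psi>_def by (metis UNIV_I finite prod_zero)
  then show ?thesis by (rule zeta_support)
qed

lemma psi_norm_support: "norm x \<le> real CARD('n) * (R + 1)" if "\<psi> \<phi> s x \<noteq> 0"
  for x :: "real ^ 'n"
proof -
  have "(\<Sum>i\<in>UNIV. \<bar>x $ i\<bar>) \<le> (\<Sum>i\<in>(UNIV :: 'n set). real_of_int R + 1)"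
    using psi_support[OF that] by (intro sum_mono) simp
  then show ?thesis using norm_le_l1_cart[of x] by simp
qed

lemma continuous_zeta: "continuous_on A (\<zeta> \<phi> r)"
proof (cases r)
  case True
  have "continuous_on A (\<lambda>x. \<phi> (2 * x - 1))"
    by (intro continuous_on_compose2[OF continuous_phi[of UNIV]] continuous_intros) auto
  then show ?thesis using True by (simp add: \<zeta>_def [abs_def])
next
  case False
  then show ?thesis using continuous_phi by (simp add: \<zeta>_def [abs_def])
qed

lemma continuous_psi: "continuous_on A (\<psi> \<phi> s)"
  unfolding \<psi>_def [abs_def]
  by (intro continuous_on_prod continuous_on_compose2[OF continuous_zeta[of UNIV]] continuous_intros) auto

lemma psi_bounded: "\<exists>M>0. \<forall>x. norm (\<psi> \<phi> s x) \<le> M"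
  for s :: "bool ^ 'n"
proof -
  have "bounded (\<psi> \<phi> s ` cball 0 (real CARD('n) * (R + 1)))"
    by (intro compact_imp_bounded compact_continuous_image continuous_psi compact_cball)
  then obtain M where M: "0 < M" "\<And>x. x \<in> cball 0 (real CARD('n) * (R + 1)) \<Longrightarrow> norm (\<psi> \<phi> s x) \<le> M"
    unfolding bounded_pos by blast
  have "norm (\<psi> \<phi> s x) \<le> M" for x
  proof (cases "\<psi> \<phi> s x = 0")
    case False
    then show ?thesis using M(2) psi_norm_support[OF False] by simp
  qed (use M in simp)
  then show ?thesis using M(1) by blast
qed

text \<open>
  A continuous function of compact support is uniformly continuous: on a ball that exceeds the
  support by \<open>1\<close> this is compactness, and points at distance less than \<open>1\<close> lie either both in that ball
  or both outside of the support.
\<close>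

lemma uniformly_continuous_psi: "uniformly_continuous_on UNIV (\<psi> \<phi> s)"
  for s :: "bool ^ 'n"
  unfolding uniformly_continuous_on_def
proof (intro allI impI)
  fix e :: real assume e: "0 < e"
  let ?r = "real CARD('n) * (R + 1)"
  have "uniformly_continuous_on (cball 0 (?r + 1)) (\<psi> \<phi> s)"
    by (intro compact_uniformly_continuous continuous_psi compact_cball)
  then obtain d where d: "0 < d"
    "\<And>x x'. x \<in> cball 0 (?r + 1) \<Longrightarrow> x' \<in> cball 0 (?r + 1) \<Longrightarrow> dist x' x < d \<Longrightarrow> dist (\<psi> \<phi> s x') (\<psi> \<phi> s x) < e"
    using e unfolding uniformly_continuous_on_def by metis
  have "dist (\<psi> \<phi> s x') (\<psi> \<phi> s x) < e" if "dist x' x < min d 1" for x x'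
  proof (cases "\<psi> \<phi> s x = 0 \<and> \<psi> \<phi> s x' = 0")
    case False
    then have "norm x \<le> ?r \<or> norm x' \<le> ?r" using psi_norm_support by blast
    moreover have "\<bar>norm x' - norm x\<bar> < 1"
      using that norm_triangle_ineq3[of x' x] by (simp add: dist_norm)
    ultimately have "norm x \<le> ?r + 1" "norm x' \<le> ?r + 1" by linarith+
    then show ?thesis using d(2)[of x x'] that by simp
  qed (use e in simp)
  then show "\<exists>d>0. \<forall>x\<in>UNIV. \<forall>x'\<in>UNIV. dist x' x < d \<longrightarrow> dist (\<psi> \<phi> s x') (\<psi> \<phi> s x) < e"
    using d(1) by (intro exI[of _ "min d 1"]) auto
qed

definition grid_floor :: "int \<Rightarrow> real ^ 'n \<Rightarrow> int ^ 'n" where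
  "grid_floor j x = (\<chi> i. \<lfloor>2 powi j * x $ i\<rfloor>)"

text \<open>
  Shifts near \<open>grid_floor j x\<close> are the only ones whose wavelets are nonzero close to \<open>x\<close>. The
  margin \<open>3\<close> consists of \<open>1\<close> for the support of \<open>\<phi>(2 \<cdot> - 1)\<close>, \<open>1\<close> for the rounding in
  \<open>grid_floor\<close>, and \<open>1\<close> for moving from \<open>x\<close> to a nearby point \<open>y\<close>.
\<close>

abbreviation neighbours :: "(int ^ 'n) set" where
  "neighbours \<equiv> vec_box {-R-3..R+3}"

lemma finite_neighbours: "finite (neighbours :: (int ^ 'n) set)"
  by (rule finite_vec_box) simp

definition wavelet_series :: "bool ^ 'n \<Rightarrow> int \<Rightarrow> (int ^ 'n \<Rightarrow> 'k) \<Rightarrow> real ^ 'n \<Rightarrow> 'k" where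
  "wavelet_series s j a = (\<lambda>x. \<Sum>\<^sub>\<infinity>k. a k * \<psi>_jk \<phi> s j k x)"

lemma psi_jk_near:
  assumes "\<psi>_jk \<phi> s j k y \<noteq> 0" and near: "\<And>i. \<bar>2 powi j * x $ i - 2 powi j * y $ i\<bar> \<le> 1"
  shows "k - grid_floor j x \<in> neighbours"
proof -
  have "(k - grid_floor j x) $ i \<in> {-R-3..R+3}" for i
  proof -
    have "\<bar>2 powi j * y $ i - of_int (k $ i)\<bar> \<le> R + 1"
      using psi_support[OF assms(1)[unfolded \<psi>_jk_def], of i] by simp
    moreover have "of_int \<lfloor>2 powi j * x $ i\<rfloor> \<le> 2 powi j * x $ i"
      "2 powi j * x $ i < of_int \<lfloor>2 powi j * x $ i\<rfloor> + 1" by linarith+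
    ultimately have "\<bar>real_of_int (k $ i - \<lfloor>2 powi j * x $ i\<rfloor>)\<bar> \<le> real_of_int (R + 3)"
      using near[of i] unfolding of_int_diff of_int_add of_int_numeral by linarith
    then have "\<bar>k $ i - \<lfloor>2 powi j * x $ i\<rfloor>\<bar> \<le> R + 3"
      by (simp only: of_int_abs [symmetric] of_int_le_iff)
    then show ?thesis by (simp add: grid_floor_def abs_le_iff)
  qed
  then show ?thesis by (simp add: vec_box_def)
qed

text \<open>
  The local form of the series: the index set does not depend on \<open>x\<close>, and for \<open>y\<close> near \<open>x\<close> the terms
  at \<open>x\<close> and at \<open>y\<close> carry the same coefficients. With \<open>y = x\<close> this yields boundedness and decay, and with
  \<open>y \<noteq> x\<close> uniform continuity.
\<close>

lemma wavelet_series_local: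
  fixes x y :: "real ^ 'n"
  assumes near: "\<And>i. \<bar>2 powi j * x $ i - 2 powi j * y $ i\<bar> \<le> 1"
  shows "wavelet_series s j a y
    = (\<Sum>b\<in>neighbours. a (grid_floor j x + b) * \<psi>_jk \<phi> s j (grid_floor j x + b) y)"
proof -
  have "wavelet_series s j a y
      = (\<Sum>\<^sub>\<infinity>k\<in>(\<lambda>b. grid_floor j x + b) ` neighbours. a k * \<psi>_jk \<phi> s j k y)"
    unfolding wavelet_series_def
  proof (rule infsum_cong_neutral)
    fix k assume k: "k \<in> UNIV - (\<lambda>b. grid_floor j x + b) ` neighbours"
    have "k - grid_floor j x \<notin> neighbours"
      using k image_eqI[of k "\<lambda>b. grid_floor j x + b" "k - grid_floor j x" neighbours] by auto
    then show "a k * \<psi>_jk \<phi> s j k y = 0" using psi_jk_near[OF _ near] by auto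
  qed auto
  also have "\<dots> = (\<Sum>k\<in>(\<lambda>b. grid_floor j x + b) ` neighbours. a k * \<psi>_jk \<phi> s j k y)"
    by (simp add: finite_neighbours)
  also have "\<dots> = (\<Sum>b\<in>neighbours. a (grid_floor j x + b) * \<psi>_jk \<phi> s j (grid_floor j x + b) y)"
    by (subst sum.reindex) (auto simp: inj_on_def)
  finally show ?thesis .
qed

lemma wavelet_series_bounded:
  fixes a :: "int ^ 'n \<Rightarrow> 'k"
  assumes "bounded (range a)"
  shows "bounded (range (wavelet_series s j a))"
proof -
  obtain A where A: "\<And>k. norm (a k) \<le> A" using assms by (auto simp: bounded_iff)
  obtain M where M: "\<And>x. norm (\<psi> \<phi> s x) \<le> M" using psi_bounded by blast
  have "norm (wavelet_series s j a x) \<le> (\<Sum>b\<in>(neighbours :: (int ^ 'n) set). A * M)" for x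
    unfolding wavelet_series_local[of j x x, simplified]
    using order_trans[OF norm_ge_zero A]
    by (intro sum_norm_le) (auto simp: norm_mult \<psi>_jk_def intro!: mult_mono A M)
  then show ?thesis unfolding bounded_iff by blast
qed

lemma wavelet_series_uniformly_continuous:
  fixes a :: "int ^ 'n \<Rightarrow> 'k"
  assumes "bounded (range a)"
  shows "uniformly_continuous_on UNIV (wavelet_series s j a)"
  unfolding uniformly_continuous_on_def
proof (intro allI impI)
  fix e :: real assume e: "0 < e"
  obtain A where A: "0 < A" "\<And>k. norm (a k) \<le> A" using assms by (auto simp: bounded_pos)
  \<comment> \<open>The summand \<open>1\<close> makes \<open>c\<close> positive and gives the strict estimate at the end.\<close>
  define c where "c = real (card (neighbours :: (int ^ 'n) set)) * A + 1"
  have c: "0 < c" using A(1) by (simp add: c_def add_nonneg_pos)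
  obtain d where d: "0 < d" "\<And>u v. dist u v < d \<Longrightarrow> dist (\<psi> \<phi> s u) (\<psi> \<phi> s v) < e / c"
    using uniformly_continuous_psi[of s] e c
    unfolding uniformly_continuous_on_def by (metis UNIV_I divide_pos_pos)
  have "dist (wavelet_series s j a y) (wavelet_series s j a x) < e"
    if xy: "dist y x < min d 1 / 2 powi j" for x y
  proof -
    have dist: "2 powi j * norm (y - x) < d" "2 powi j * norm (y - x) < 1"
      using xy by (simp_all add: dist_norm field_simps)
    have near: "\<bar>2 powi j * x $ i - 2 powi j * y $ i\<bar> \<le> 1" for i
    proof -
      have "\<bar>2 powi j * x $ i - 2 powi j * y $ i\<bar> = 2 powi j * \<bar>(y - x) $ i\<bar>"
        by (simp flip: right_diff_distrib add: abs_mult abs_minus_commute)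
      also have "\<dots> \<le> 2 powi j * norm (y - x)"
        by (intro mult_left_mono component_le_norm_cart) simp
      finally show ?thesis using dist by linarith
    qed
    have diff: "dist (\<psi>_jk \<phi> s j k y) (\<psi>_jk \<phi> s j k x) < e / c" for k
      unfolding \<psi>_jk_def
    proof (rule d(2))
      have "(\<chi> i. 2 powi j * y $ i - of_int (k $ i)) - (\<chi> i. 2 powi j * x $ i - of_int (k $ i))
          = (2 powi j) *\<^sub>R (y - x)"
        by (simp add: vec_eq_iff right_diff_distrib)
      then show "dist (\<chi> i. 2 powi j * y $ i - of_int (k $ i)) (\<chi> i. 2 powi j * x $ i - of_int (k $ i)) < d"
        using dist by (simp add: dist_norm)
    qed
    have "wavelet_series s j a y - wavelet_series s j a x
      = (\<Sum>b\<in>neighbours. a (grid_floor j x + b) *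
          (\<psi>_jk \<phi> s j (grid_floor j x + b) y - \<psi>_jk \<phi> s j (grid_floor j x + b) x))"
      by (simp add: wavelet_series_local[OF near] wavelet_series_local[of j x x, simplified]
          right_diff_distrib sum_subtractf)
    also have "norm \<dots> \<le> (\<Sum>b\<in>(neighbours :: (int ^ 'n) set). A * (e / c))"
      using A diff unfolding dist_norm
      by (intro sum_norm_le) (simp only: norm_mult, intro mult_mono, auto intro: less_imp_le)
    also have "\<dots> = (c - 1) * (e / c)" by (simp add: c_def)
    also have "\<dots> < e" using c e by (simp add: field_simps)
    finally show ?thesis by (simp add: dist_norm)
  qed
  then show "\<exists>d>0. \<forall>x\<in>UNIV. \<forall>y\<in>UNIV. dist y x < d \<longrightarrow>
      dist (wavelet_series s j a y) (wavelet_series s j a x) < e"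
    using d(1) by (intro exI[of _ "min d 1 / 2 powi j"]) auto
qed

text \<open>
  Each multi-index is attained on a bounded set of points only, so the coefficients that occur in the
  local form of the series at \<open>x\<close> tend to \<open>0\<close> as \<open>x\<close> tends to infinity.
\<close>

lemma filterlim_grid_floor: "filterlim (\<lambda>x. grid_floor j x + b) cofinite at_infinity"
  for b :: "int ^ 'n"
  unfolding filterlim_iff
proof (intro allI impI)
  fix P :: "int ^ 'n \<Rightarrow> bool" assume "eventually P cofinite"
  then have fin: "finite {k. \<not> P k}" by (simp add: eventually_cofinite)
  have "\<forall>\<^sub>F x in at_infinity. grid_floor j x + b \<noteq> k" for k
  proof -
    define r where "r = (\<Sum>i\<in>UNIV. (\<bar>real_of_int (k $ i - b $ i)\<bar> + 1) / 2 powi j) + 1"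
    have "grid_floor j x + b \<noteq> k" if "r \<le> norm x" for x
    proof
      assume eq: "grid_floor j x + b = k"
      have "\<bar>x $ i\<bar> \<le> (\<bar>real_of_int (k $ i - b $ i)\<bar> + 1) / 2 powi j" for i
      proof -
        have "\<lfloor>2 powi j * x $ i\<rfloor> = k $ i - b $ i" using eq by (auto simp: grid_floor_def)
        then have "\<bar>2 powi j * x $ i\<bar> \<le> \<bar>real_of_int (k $ i - b $ i)\<bar> + 1" by linarith
        then show ?thesis by (simp add: abs_mult field_simps)
      qed
      then have "norm x \<le> r - 1"
        unfolding r_def using norm_le_l1_cart[of x] by (simp add: order_trans sum_mono)
      then show False using that by simp
    qed
    then show ?thesis unfolding eventually_at_infinity by blast
  qed
  then have "\<forall>\<^sub>F x in at_infinity. \<forall>k\<in>{k. \<not> P k}. grid_floor j x + b \<noteq> k"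
    using fin by (intro eventually_ball_finite) auto
  then show "\<forall>\<^sub>F x in at_infinity. P (grid_floor j x + b)"
    by eventually_elim auto
qed

lemma wavelet_series_vanishes_at_infinity:
  fixes a :: "int ^ 'n \<Rightarrow> 'k"
  assumes "(a \<longlongrightarrow> 0) cofinite"
  shows "(wavelet_series s j a \<longlongrightarrow> 0) at_infinity"
proof -
  obtain M where M: "\<And>x. norm (\<psi> \<phi> s x) \<le> M" using psi_bounded by blast
  have "((\<lambda>x. \<Sum>b\<in>neighbours. a (grid_floor j x + b) * \<psi>_jk \<phi> s j (grid_floor j x + b) x) \<longlongrightarrow> 0)
      at_infinity"
  proof (rule tendsto_null_sum)
    fix b :: "int ^ 'n"
    have "((\<lambda>x. a (grid_floor j x + b)) \<longlongrightarrow> 0) at_infinity"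
      by (rule filterlim_compose[OF assms filterlim_grid_floor])
    then have "((\<lambda>x. norm (a (grid_floor j x + b)) * M) \<longlongrightarrow> 0) at_infinity"
      by (intro tendsto_mult_left_zero tendsto_norm_zero)
    then show "((\<lambda>x. a (grid_floor j x + b) * \<psi>_jk \<phi> s j (grid_floor j x + b) x) \<longlongrightarrow> 0) at_infinity"
      by (rule Lim_null_comparison[rotated])
        (auto simp: norm_mult \<psi>_jk_def intro!: always_eventually mult_left_mono M)
  qed
  then show ?thesis
    by (simp add: wavelet_series_local[of j x x for x, simplified, abs_def])
qed

lemma null_family_bounded:
  fixes a :: "int ^ 'n \<Rightarrow> 'k"
  assumes "(a \<longlongrightarrow> 0) cofinite"
  shows "bounded (range a)"
proof -
  have "finite {k. \<not> norm (a k) < 1}"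
    using tendstoD[OF assms, of 1] by (simp add: eventually_cofinite)
  then have "bounded (a ` {k. \<not> norm (a k) < 1} \<union> ball 0 1)"
    by (simp add: finite_imp_bounded)
  then show ?thesis by (rule bounded_subset) auto
qed

lemma wavelet_series_mem_E:
  assumes "E = C_u \<or> E = C_0" and a: "a \<in> coeff_space E"
  shows "wavelet_series s j a \<in> E"
proof (cases "E = C_u")
  case True
  then show ?thesis
    using a
    by (simp add: coeff_space_def C_u_def wavelet_series_bounded wavelet_series_uniformly_continuous)
next
  case False
  then have lim: "(a \<longlongrightarrow> 0) cofinite" and E: "E = C_0"
    using assms by (auto simp: coeff_space_def)
  show ?thesis
    unfolding E C_0_def
    using wavelet_series_vanishes_at_infinity[OF lim]
      uniformly_continuous_imp_continuous[OF wavelet_series_uniformly_continuous[OF null_family_bounded[OF lim]]]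
    by simp
qed

text \<open>
  The functional evaluates at finitely many points, and at these points only the wavelets from one
  common finite set \<open>K\<close> are nonzero, so that the sum over the coefficients can be pulled out.
\<close>

lemma dual_psi_wavelet_series:
  fixes E :: "(real ^ 'n \<Rightarrow> 'k) set"
  assumes "wavelet_series t j' a \<in> E"
    and zero: "\<And>m. (\<Prod>i\<in>UNIV. pairing (s $ i) (t $ i) (j' - j) (k $ i) (m $ i)) = 0"
  shows "dual_\<psi> E \<phi> s j k (wavelet_series t j' a) = 0"
proof -
  define p where "p l = (\<chi> i. real_of_int (2 * k $ i + l $ i) / 2 powi (j + 1))" for l
  let ?B = "vec_box filter_support :: (int ^ 'n) set"
  define K where "K = (\<Union>l\<in>?B. (\<lambda>b. grid_floor j' (p l) + b) ` neighbours)"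
  have fin: "finite K"
    unfolding K_def by (intro finite_UN_I finite_imageI finite_vec_box) auto
  have "wavelet_series t j' a (p l) = (\<Sum>m\<in>K. a m * \<psi>_jk \<phi> t j' m (p l))" if l: "l \<in> ?B" for l
  proof -
    have "m \<in> K" if "\<psi>_jk \<phi> t j' m (p l) \<noteq> 0" for m
      using psi_jk_near[OF that, of "p l"] l unfolding K_def
      by (auto intro!: bexI[of _ l] image_eqI[of _ _ "m - grid_floor j' (p l)"])
    then have "wavelet_series t j' a (p l) = (\<Sum>\<^sub>\<infinity>m\<in>K. a m * \<psi>_jk \<phi> t j' m (p l))"
      unfolding wavelet_series_def by (intro infsum_cong_neutral) auto
    then show ?thesis using fin by simp
  qed
  then have "dual_\<psi> E \<phi> s j k (wavelet_series t j' a)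
    = (\<Sum>l\<in>?B. \<Sum>m\<in>K. a m * (dual_filter \<phi> s l * \<psi>_jk \<phi> t j' m (p l)))"
    unfolding dual_psi_eq_sum[OF assms(1)] p_def [symmetric]
    by (intro sum.cong) (auto simp: sum_distrib_left mult.left_commute)
  also have "\<dots> = (\<Sum>m\<in>K. a m * (\<Sum>l\<in>?B. dual_filter \<phi> s l * \<psi>_jk \<phi> t j' m (p l)))"
    by (subst sum.swap) (simp only: sum_distrib_left)
  also have "\<dots> = 0"
    unfolding p_def dual_psi_psi zero by simp
  finally show ?thesis .
qed

section \<open>Orthogonality\<close>

lemma W_s_eq: "W_s E \<phi> s j = wavelet_series s j ` coeff_space E"
  by (auto simp: W_s_def wavelet_series_def)

lemma W_s_subset: "E = C_u \<or> E = C_0 \<Longrightarrow> W_s E \<phi> s j \<subseteq> E"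
  using wavelet_series_mem_E by (auto simp: W_s_eq)

lemma perp_if_pairing_zero:
  fixes E :: "(real ^ 'n \<Rightarrow> 'k) set"
  assumes E: "E = C_u \<or> E = C_0" and zero: "\<And>q c. pairing (s $ i) (t $ i) (j' - j) q c = 0"
  shows "dual_W_s E \<phi> s j \<perp> W_s E \<phi> t j'"
  unfolding perp_def
proof (intro ballI)
  fix b f assume b: "b \<in> dual_W_s E \<phi> s j" and f: "f \<in> W_s E \<phi> t j'"
  obtain d where d: "dual_has_sum E (\<lambda>k f. d k * dual_\<psi> E \<phi> s j k f) b"
    using b by (auto simp: dual_W_s_def)
  obtain a where a: "f = wavelet_series t j' a" using f by (auto simp: W_s_eq)
  have fE: "f \<in> E" using f W_s_subset[OF E] by blast
  have "(\<Prod>i\<in>UNIV. pairing (s $ i) (t $ i) (j' - j) (k $ i) (m $ i)) = 0" for k m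
    by (rule prod_zero[OF finite]) (use zero in blast)
  then have "dual_\<psi> E \<phi> s j k f = 0" for k
    using dual_psi_wavelet_series fE unfolding a by blast
  then show "b f = 0"
    by (rule dual_has_sum_zero[OF E dual_psi_mem_dual[OF E] d fE])
qed

lemma dual_psi_mem_dual_W_s:
  assumes E: "E = C_u \<or> E = C_0" shows "dual_\<psi> E \<phi> s j k \<in> dual_W_s E \<phi> s j"
proof -
  let ?d = "\<lambda>k'. if k' = k then 1 else 0 :: 'k"
  have "(\<lambda>k'. norm (?d k')) summable_on {k}" by simp
  then have "(\<lambda>k'. norm (?d k')) summable_on UNIV"
    by (rule summable_on_cong_neutral[THEN iffD1, rotated -1]) auto
  moreover have "dual_has_sum E (\<lambda>k f. ?d k * dual_\<psi> E \<phi> s j k f) (dual_\<psi> E \<phi> s j k)"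
    by (rule dual_has_sum_single[OF E dual_psi_mem_dual[OF E], where k = k]) auto
  ultimately show ?thesis unfolding dual_W_s_def by (intro CollectI exI[of _ ?d] conjI)
qed

lemma zero_mem_dual_W_s:
  assumes E: "E = C_u \<or> E = C_0" shows "restrict (\<lambda>f. 0) E \<in> dual_W_s E \<phi> s j"
proof -
  have "dual_has_sum E (\<lambda>k f. 0 * dual_\<psi> E \<phi> s j k f) (restrict (\<lambda>f. 0) E)"
    by (rule dual_has_sum_single[OF E dual_zero[OF E]]) auto
  then show ?thesis unfolding dual_W_s_def by (auto intro!: exI[of _ "\<lambda>_. 0"])
qed

lemma psi_jk_mem_W_s: "\<psi>_jk \<phi> s j k \<in> W_s E \<phi> s j"
proof -
  let ?a = "\<lambda>k'. if k' = k then 1 else 0 :: 'k"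
  have "wavelet_series s j ?a x = (\<Sum>\<^sub>\<infinity>k'\<in>{k}. ?a k' * \<psi>_jk \<phi> s j k' x)" for x
    unfolding wavelet_series_def by (rule infsum_cong_neutral) auto
  then have "\<psi>_jk \<phi> s j k = wavelet_series s j ?a" by auto
  moreover have "bounded (range ?a)" by (rule finite_imp_bounded) (auto intro: finite_subset[of _ "{0,1}"])
  moreover have "(?a \<longlongrightarrow> 0) cofinite"
    by (rule tendsto_eventually) (auto simp: eventually_cofinite)
  ultimately show ?thesis unfolding W_s_eq coeff_space_def by auto
qed

lemma zero_mem_W_s: "(\<lambda>x. 0) \<in> W_s E \<phi> s j"
  unfolding W_s_eq by (rule image_eqI[of _ _ "\<lambda>k. 0"]) (auto simp: wavelet_series_def coeff_space_def)

text \<open>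
  The shifts are taken equal in all coordinates. The sets \<open>A\<close> and \<open>B\<close> are kept general so that the
  lemma applies to the spaces for a single index and to the direct sums alike.
\<close>

lemma not_perp_if_pairing_nonzero:
  fixes E :: "(real ^ 'n \<Rightarrow> 'k) set"
  assumes E: "E = C_u \<or> E = C_0" and nz: "\<And>i. pairing (s $ i) (t $ i) (j' - j) q c \<noteq> 0"
    and B: "\<And>k. dual_\<psi> E \<phi> s j k \<in> B" and A: "\<And>m. \<psi>_jk \<phi> t j' m \<in> A"
  shows "\<not> B \<perp> A"
proof -
  have "\<psi>_jk \<phi> t j' m \<in> E" for m using psi_jk_mem_W_s W_s_subset[OF E] by blast
  then have "dual_\<psi> E \<phi> s j (\<chi> i. q) (\<psi>_jk \<phi> t j' (\<chi> i. c))
      = (\<Prod>i\<in>UNIV. pairing (s $ i) (t $ i) (j' - j) q c)"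
    using dual_psi_psi[of s t j' "\<chi> i. c" "\<chi> i. q" j] by (simp add: dual_psi_eq_sum)
  moreover have "\<dots> \<noteq> 0" using nz by simp
  ultimately show ?thesis using A B unfolding perp_def by metis
qed

text \<open>
  All summands other than the one for \<open>s\<close> are taken to be zero; the same is done for the dual spaces
  below.
\<close>

lemma mem_W:
  assumes "f \<in> W_s E \<phi> s j" "s \<noteq> zero_index" shows "f \<in> W E \<phi> j"
proof -
  have "f = (\<lambda>x. \<Sum>t\<in>UNIV - {zero_index}. (if t = s then f else (\<lambda>x. 0)) x)"
  proof
    fix x
    have "(\<Sum>t\<in>UNIV - {zero_index}. (if t = s then f else (\<lambda>x. 0)) x)
        = (\<Sum>t\<in>UNIV - {zero_index}. if t = s then f x else 0)"
      by (rule sum.cong) auto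
    then show "f x = (\<Sum>t\<in>UNIV - {zero_index}. (if t = s then f else (\<lambda>x. 0)) x)"
      using assms by simp
  qed
  then show ?thesis
    unfolding W_def using assms zero_mem_W_s
    by (intro CollectI exI[of _ "\<lambda>t. if t = s then f else (\<lambda>x. 0)"]) auto
qed

lemma mem_dual_W:
  assumes E: "E = C_u \<or> E = C_0" and b: "b \<in> dual_W_s E \<phi> s j" "s \<noteq> zero_index"
  shows "b \<in> dual_W E \<phi> j"
proof -
  have ext: "b \<in> extensional E"
    using b by (auto simp: dual_W_s_def dual_has_sum_def dual_def)
  have "b = restrict (\<lambda>f. \<Sum>t\<in>UNIV - {zero_index}. (if t = s then b else restrict (\<lambda>f. 0) E) f) E"
  proof
    fix f
    have "(\<Sum>t\<in>UNIV - {zero_index}. (if t = s then b else restrict (\<lambda>f. 0) E) f)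
        = (\<Sum>t\<in>UNIV - {zero_index}. if t = s then b f else 0)" if "f \<in> E"
      using that by (intro sum.cong) auto
    then show "b f = restrict (\<lambda>f. \<Sum>t\<in>UNIV - {zero_index}. (if t = s then b else restrict (\<lambda>f. 0) E) f) E f"
      using b(2) ext by (cases "f \<in> E") (auto simp: extensional_def)
  qed
  then show ?thesis
    unfolding dual_W_def using b(1) zero_mem_dual_W_s[OF E]
    by (intro CollectI exI[of _ "\<lambda>t. if t = s then b else restrict (\<lambda>f. 0) E"]) auto
qed

lemma dual_W_s_subset: "dual_W_s E \<phi> s j \<subseteq> dual E"
  by (auto simp: dual_W_s_def dual_has_sum_def)

lemma perp_W:
  fixes E :: "(real ^ 'n \<Rightarrow> 'k) set"
  assumes E: "E = C_u \<or> E = C_0" and B: "B \<subseteq> dual E" "\<And>t. t \<noteq> zero_index \<Longrightarrow> B \<perp> W_s E \<phi> t j"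
  shows "B \<perp> W E \<phi> j"
  unfolding perp_def
proof (intro ballI)
  fix b f assume b: "b \<in> B" and "f \<in> W E \<phi> j"
  then obtain w where f: "f = (\<lambda>x. \<Sum>s\<in>UNIV - {zero_index}. w s x)"
    and w: "\<And>s. s \<in> UNIV - {zero_index} \<Longrightarrow> w s \<in> W_s E \<phi> s j"
    unfolding W_def by blast
  have "w s \<in> E" if "s \<in> UNIV - {zero_index}" for s
    using w[OF that] W_s_subset[OF E] by blast
  then have "b f = (\<Sum>s\<in>UNIV - {zero_index}. b (w s))"
    unfolding f using b B(1) by (intro dual_additive_sum[OF E, THEN conjunct2]) auto
  also have "\<dots> = 0"
    using w b B(2) by (intro sum.neutral) (auto simp: perp_def)
  finally show "b f = 0" .
qed

lemma dual_W_perp: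
  assumes "A \<subseteq> E" "\<And>s. s \<noteq> zero_index \<Longrightarrow> dual_W_s E \<phi> s j \<perp> A"
  shows "dual_W E \<phi> j \<perp> A"
  using assms unfolding perp_def dual_W_def by (fastforce intro!: sum.neutral)

lemma W_subset:
  assumes E: "E = C_u \<or> E = C_0"
  shows "W E \<phi> j \<subseteq> (E :: (real ^ 'n \<Rightarrow> 'k) set)"
proof
  fix f assume "f \<in> W E \<phi> j"
  then obtain w where f: "f = (\<lambda>x. \<Sum>s\<in>UNIV - {zero_index}. w s x)"
    and w: "\<And>s. s \<in> UNIV - {zero_index} \<Longrightarrow> w s \<in> W_s E \<phi> s j"
    unfolding W_def by blast
  have "w s \<in> E" if "s \<in> UNIV - {zero_index}" for s
    using w[OF that] W_s_subset[OF E] by blast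
  then show "f \<in> E"
    unfolding f by (intro dual_additive_sum[OF E dual_zero[OF E], THEN conjunct1]) auto
qed

end

lemma exists_support_radius:
  assumes "mother_scaling_function \<phi>"
  shows "\<exists>R. mother_scaling \<phi> R"
proof -
  have "bounded (closure {x. \<phi> x \<noteq> 0})"
    using assms compact_imp_bounded unfolding mother_scaling_function_def by blast
  then obtain r where "\<forall>x\<in>closure {x. \<phi> x \<noteq> 0}. norm x \<le> r"
    unfolding bounded_iff by blast
  then have r: "\<bar>x\<bar> \<le> r" if "\<phi> x \<noteq> 0" for x
    using closure_subset[of "{x. \<phi> x \<noteq> 0}"] that by auto
  have "mother_scaling \<phi> \<lceil>r\<rceil>"
  proof
    fix x assume "real_of_int \<lceil>r\<rceil> < \<bar>x\<bar>"
    then have "\<not> \<bar>x\<bar> \<le> r" by linarith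
    then show "\<phi> x = 0" using r by blast
  qed fact
  then show ?thesis by blast
qed

lemma nonzero_index: "s \<noteq> zero_index \<longleftrightarrow> (\<exists>i. s $ i)"
  by (auto simp: zero_index_def vec_eq_iff)

theorem theorem8p14:
  fixes \<phi> :: "real \<Rightarrow> 'k :: {real_normed_field, banach}"
    and E :: "(real ^ 'n \<Rightarrow> 'k) set"
  assumes "mother_scaling_function \<phi>"
    and "E = C_u \<or> E = C_0"
  shows "(\<forall>j s t. s \<noteq> t \<longleftrightarrow> dual_W_s E \<phi> s j \<perp> W_s E \<phi> t j)
    \<and> (\<forall>j\<^sub>1 j\<^sub>2. j\<^sub>1 \<le> j\<^sub>2 \<longleftrightarrow> dual_V E \<phi> j\<^sub>1 \<perp> W E \<phi> j\<^sub>2)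
    \<and> (\<forall>j\<^sub>1 j\<^sub>2. j\<^sub>1 \<ge> j\<^sub>2 \<longleftrightarrow> dual_W E \<phi> j\<^sub>1 \<perp> V E \<phi> j\<^sub>2)
    \<and> (\<forall>j\<^sub>1 j\<^sub>2. j\<^sub>1 \<noteq> j\<^sub>2 \<longleftrightarrow> dual_W E \<phi> j\<^sub>1 \<perp> W E \<phi> j\<^sub>2)"
proof -
  obtain R where "mother_scaling \<phi> R" using exists_support_radius[OF assms(1)] by blast
  then interpret mother_scaling \<phi> R .
  note E = assms(2)
  let ?ones = "(\<chi> i. True) :: bool ^ 'n"
  have ones: "?ones \<noteq> zero_index" by (simp add: nonzero_index)
  have zero: "zero_index $ i = False" for i :: 'n by (simp add: zero_index_def)

  have "s \<noteq> t \<longleftrightarrow> dual_W_s E \<phi> s j \<perp> W_s E \<phi> t j" for j s t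
  proof
    assume "s \<noteq> t"
    then obtain i where "s $ i \<noteq> t $ i" by (auto simp: vec_eq_iff)
    then have "pairing (s $ i) (t $ i) (j - j) q c = 0" for q c
      using pairing_False_True[of 0] pairing_True_False[of 0] by (cases "s $ i") auto
    then show "dual_W_s E \<phi> s j \<perp> W_s E \<phi> t j"
      by (rule perp_if_pairing_zero[OF E])
  next
    have "\<not> dual_W_s E \<phi> s j \<perp> W_s E \<phi> s j"
      by (rule not_perp_if_pairing_nonzero[OF E, where q = 0 and c = 0 and s = s and t = s and j = j and j' = j])
        (auto simp: pairing_diagonal dual_psi_mem_dual_W_s[OF E] psi_jk_mem_W_s)
    then show "dual_W_s E \<phi> s j \<perp> W_s E \<phi> t j \<Longrightarrow> s \<noteq> t" by blast
  qed
  moreover have "j\<^sub>1 \<le> j\<^sub>2 \<longleftrightarrow> dual_V E \<phi> j\<^sub>1 \<perp> W E \<phi> j\<^sub>2" for j\<^sub>1 j\<^sub>2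
  proof
    assume le: "j\<^sub>1 \<le> j\<^sub>2"
    show "dual_V E \<phi> j\<^sub>1 \<perp> W E \<phi> j\<^sub>2"
      unfolding dual_V_def
    proof (rule perp_W[OF E dual_W_s_subset])
      fix t :: "bool ^ 'n" assume "t \<noteq> zero_index"
      then obtain i where i: "t $ i" by (auto simp: nonzero_index)
      show "dual_W_s E \<phi> zero_index j\<^sub>1 \<perp> W_s E \<phi> t j\<^sub>2"
        by (rule perp_if_pairing_zero[OF E, where i = i])
          (use i le in \<open>simp add: zero pairing_False_True\<close>)
    qed
  next
    assume perp: "dual_V E \<phi> j\<^sub>1 \<perp> W E \<phi> j\<^sub>2"
    show "j\<^sub>1 \<le> j\<^sub>2"
    proof (rule ccontr)
      assume "\<not> j\<^sub>1 \<le> j\<^sub>2"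
      then have "pairing False True (j\<^sub>2 - j\<^sub>1) (2 ^ nat (- (j\<^sub>2 - j\<^sub>1) - 1)) 0 = 1"
        by (intro pairing_False_True_witness) simp
      then have "\<not> dual_V E \<phi> j\<^sub>1 \<perp> W E \<phi> j\<^sub>2"
        unfolding dual_V_def
        by (intro not_perp_if_pairing_nonzero[OF E, where s = zero_index and t = ?ones and j = j\<^sub>1 and j' = j\<^sub>2
              and q = "2 ^ nat (- (j\<^sub>2 - j\<^sub>1) - 1)" and c = 0])
          (simp_all add: zero dual_psi_mem_dual_W_s[OF E] mem_W[OF psi_jk_mem_W_s ones])
      then show False using perp by blast
    qed
  qed
  moreover have "j\<^sub>1 \<ge> j\<^sub>2 \<longleftrightarrow> dual_W E \<phi> j\<^sub>1 \<perp> V E \<phi> j\<^sub>2" for j\<^sub>1 j\<^sub>2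
  proof
    assume le: "j\<^sub>1 \<ge> j\<^sub>2"
    show "dual_W E \<phi> j\<^sub>1 \<perp> V E \<phi> j\<^sub>2"
      unfolding V_def
    proof (rule dual_W_perp[OF W_s_subset[OF E]])
      fix s :: "bool ^ 'n" assume "s \<noteq> zero_index"
      then obtain i where i: "s $ i" by (auto simp: nonzero_index)
      show "dual_W_s E \<phi> s j\<^sub>1 \<perp> W_s E \<phi> zero_index j\<^sub>2"
        by (rule perp_if_pairing_zero[OF E, where i = i])
          (use i le in \<open>simp add: zero pairing_True_False\<close>)
    qed
  next
    assume perp: "dual_W E \<phi> j\<^sub>1 \<perp> V E \<phi> j\<^sub>2"
    show "j\<^sub>1 \<ge> j\<^sub>2"
    proof (rule ccontr)
      assume "\<not> j\<^sub>1 \<ge> j\<^sub>2"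
      then have "pairing True False (j\<^sub>2 - j\<^sub>1) 0 (2 ^ nat (j\<^sub>2 - j\<^sub>1 - 1)) = 1"
        by (intro pairing_True_False_witness) simp
      then have "\<not> dual_W E \<phi> j\<^sub>1 \<perp> V E \<phi> j\<^sub>2"
        unfolding V_def
        by (intro not_perp_if_pairing_nonzero[OF E, where s = ?ones and t = zero_index and j = j\<^sub>1 and j' = j\<^sub>2
              and q = 0 and c = "2 ^ nat (j\<^sub>2 - j\<^sub>1 - 1)"])
          (simp_all add: zero psi_jk_mem_W_s mem_dual_W[OF E dual_psi_mem_dual_W_s[OF E] ones])
      then show False using perp by blast
    qed
  qed
  moreover have "j\<^sub>1 \<noteq> j\<^sub>2 \<longleftrightarrow> dual_W E \<phi> j\<^sub>1 \<perp> W E \<phi> j\<^sub>2" for j\<^sub>1 j\<^sub>2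
  proof
    assume ne: "j\<^sub>1 \<noteq> j\<^sub>2"
    show "dual_W E \<phi> j\<^sub>1 \<perp> W E \<phi> j\<^sub>2"
    proof (rule dual_W_perp[OF W_subset[OF E]], rule perp_W[OF E dual_W_s_subset])
      fix s t :: "bool ^ 'n" assume "s \<noteq> zero_index" "t \<noteq> zero_index"
      \<comment> \<open>A coordinate where \<open>t\<close> is \<open>1\<close> serves for \<open>j\<^sub>1 < j\<^sub>2\<close>, and one where \<open>s\<close> is \<open>1\<close> for
        \<open>j\<^sub>1 > j\<^sub>2\<close>.\<close>
      then obtain i i' where i: "s $ i" and i': "t $ i'" by (auto simp: nonzero_index)
      show "dual_W_s E \<phi> s j\<^sub>1 \<perp> W_s E \<phi> t j\<^sub>2"
      proof (cases "j\<^sub>1 < j\<^sub>2")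
        case True
        show ?thesis
          by (rule perp_if_pairing_zero[OF E, where i = i'])
            (use i' True in \<open>simp add: pairing_True_fine\<close>)
      next
        case False
        have "pairing True (t $ i) (j\<^sub>2 - j\<^sub>1) q c = 0" for q c
          using False ne by (cases "t $ i") (simp_all add: pairing_True_False pairing_True_True_coarse)
        then show ?thesis
          by (intro perp_if_pairing_zero[OF E, where i = i]) (use i in simp)
      qed
    qed
  next
    assume perp: "dual_W E \<phi> j\<^sub>1 \<perp> W E \<phi> j\<^sub>2"
    have "\<not> dual_W E \<phi> j \<perp> W E \<phi> j" for j
      by (intro not_perp_if_pairing_nonzero[OF E, where s = ?ones and t = ?ones and j = j and j' = j
            and q = 0 and c = 0])
        (simp_all add: pairing_diagonal mem_W[OF psi_jk_mem_W_s ones]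
          mem_dual_W[OF E dual_psi_mem_dual_W_s[OF E] ones])
    then show "j\<^sub>1 \<noteq> j\<^sub>2" using perp by blast
  qed
  ultimately show ?thesis by blast
qed

end
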